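(* Let $T=(\Sigma,E)$ be a graded nominal theory, let $X$ be a nominal set, and suppose that the judgement $X\vdash_m t=u$ (with $t,u\in\mathsf{Term}_{\Sigma,m}(X)$) is derivable in $T$. Then for every $n\le\omega$, every $(T,n)$-model satisfies $X\vdash_m t=u$.
   Context: Nominal sets: fix a countably infinite set $\mathbb{A}$ of names and let $G$ be the group of finite permutations of $\mathbb{A}$; $(a\,b)$ is the transposition of $a,b$. A nominal set is a set $X$ with a left $G$-action $(\pi,x)\mapsto\pi\cdot x$ such that every $x$ has a finite support, i.e. a finite $S\subseteq\mathbb{A}$ such that $\pi\cdot x=x$ for every $\pi\in G$ fixing $S$ pointwise; $\mathsf{supp}(x)$ is the least such $S$, and $a\# x$ means $a\notin\mathsf{supp}(x)$. A map $f$ between nominal sets is equivariant if $f(\pi\cdot x)=\pi\cdot f(x)$. A nominal set is orbit-finite if it has finitely many orbits. $\mathbb{A}$ is a nominal set via $\pi\cdot a=\pi(a)$; products carry the componentwise action. For a nominal set $X$, $[\mathbb{A}]X$ is the quotient of $\mathbb{A}\times X$ by $(a,x)\sim(b,y)$ iff $(c\,a)\cdot x=(c\,b)\cdot y$ for some $c$ fresh for $a,b,x,y$; the class of $(a,x)$ is written $\langle a\rangle x$, and $\pi\cdot\langle a\rangle x=\langle \pi(a)\rangle(\pi\cdot x)$. Signatures and terms: a nominal graded signature $\Sigma$ is a disjoint union of sets $\Sigma_0$ (pure), $\Sigma_{\mathsf f}$ (free) and $\Sigma_{\mathsf b}$ (bound) of operations, each $f$ having an arity $\mathsf{ar}(f)\in\mathbb{N}$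 and a depth $d(f)\in\mathbb{N}$. For a nominal set $X$ of variables, terms are given by $t::=x\mid f(t_1,\dots,t_p)\mid a.g(t_1,\dots,t_p)\mid \nu a.h(t_1,\dots,t_p)$ with $x\in X$, $a\in\mathbb{A}$, $f\in\Sigma_0$, $g\in\Sigma_{\mathsf f}$, $h\in\Sigma_{\mathsf b}$ of arity $p$. We write $\eta.f(t_1,\dots,t_p)$ generically, the prefix $\eta$ being empty, $a$, or $\nu a$ according to whether $f\in\Sigma_0,\Sigma_{\mathsf f},\Sigma_{\mathsf b}$. Uniform depth: variables have uniform depth $0$; $\eta.f(t_1,\dots,t_p)$ has uniform depth $m+d(f)$ whenever all $t_i$ have uniform depth $m$. $\mathsf{Term}_{\Sigma,m}(X)$ is the set of terms of uniform depth $m$; it is a nominal set under $\pi\cdot x$ (action of $X$), $\pi\cdot f(\vec t)=f(\pi\cdot\vec t)$, $\pi\cdot a.g(\vec t)=\pi(a).g(\pi\cdot \vec t)$, $\pi\cdot\nu a.h(\vec t)=\nu\pi(a).h(\pi\cdot\vec t)$ (terms are raw, not quotiented). A substitution $\sigma\colon Y\to\mathsf{Term}_{\Sigma,l}(X)$ acts on terms by $t\sigma$ = replace each variable $y$ by $\sigma(y)$, without renaming bound names. Theories and derivations: a depth-$n$ equation $X\vdash_n t=u$ consists of an orbit-finite nominal set $X$ and $t,u\in\mathsf{Term}_{\Sigma,n}(X)$. A graded theory $T=(\Sigma,E)$ is a signature with a set $E$ of equations (axioms). Derivable judgements $X\vdash_m t=u$ ($X$ a nominal set, $t,u\in \mathsf{Term}_{\Sigma,m}(X)$)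 are the least set closed under: (refl) $X\vdash_0 x=x$ for $x\in X$; (symm) from $X\vdash_m u=t$ infer $X\vdash_m t=u$; (trans) from $X\vdash_m t=v$ and $X\vdash_m v=u$ infer $X\vdash_m t=u$; (cong) from $X\vdash_m t_i=u_i$ ($i=1..p$) infer $X\vdash_{m+d(f)}\eta.f(t_1,..,t_p)=\eta.f(u_1,..,u_p)$ for $f\in\Sigma$ of arity $p$; (ax) for an axiom $Y\vdash_m r=s$ in $E$, $\tau\in G$ and $\sigma\colon Y\to \mathsf{Term}_{\Sigma,l}(X)$ such that $X\vdash_l \pi\cdot\sigma(y)=\sigma(\pi\cdot y)$ is derivable for all $\pi\in G$, $y\in Y$, infer $X\vdash_{m+l}(\tau\cdot r)\sigma=(\tau\cdot s)\sigma$; (perm) for $h\in\Sigma_{\mathsf b}$ of arity $p$ and names $a\ne b$ with $a\# u_i$ for all $i$, from $X\vdash_m t_i=(a\,b)\cdot u_i$ ($i=1..p$) infer $X\vdash_{m+d(h)}\nu a.h(t_1,..,t_p)=\nu b.h(u_1,..,u_p)$. Algebras and models: for $n\le\omega$, a nominal $(\Sigma,n)$-algebra $A$ consists of nominal sets $A_i$ ($0\le i\le n$, resp. $i<\omega$ if $n=\omega$) and, for each $f\in\Sigma$ of arity $p$ and each $m$ with $m+d(f)\le n$ (all $m$ if $n=\omega$), an equivariant map $f_{A,m}$ of type $A_m^p\to A_{m+d(f)}$ if $f\in\Sigma_0$, $\mathbb{A}\times A_m^p\to A_{m+d(f)}$ if $f\in\Sigma_{\mathsf f}$, $[\mathbb{A}](A_m^p)\to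 A_{m+d(f)}$ if $f\in\Sigma_{\mathsf b}$. For an equivariant valuation $\iota\colon X\to A_k$ and $t\in\mathsf{Term}_{\Sigma,m}(X)$ with $k+m\le n$, the value $[\![t]\!]^\iota_m\in A_{k+m}$ is defined by $[\![x]\!]^\iota_0=\iota(x)$, $[\![f(\vec t)]\!]^\iota_{m+d(f)}=f_{A,k+m}([\![t_1]\!]^\iota_m,\dots)$, $[\![a.f(\vec t)]\!]^\iota_{m+d(f)}=f_{A,k+m}(a,[\![t_1]\!]^\iota_m,\dots)$, $[\![\nu a.f(\vec t)]\!]^\iota_{m+d(f)}=f_{A,k+m}(\langle a\rangle([\![t_1]\!]^\iota_m,\dots,[\![t_p]\!]^\iota_m))$. $A$ satisfies $X\vdash_m t=u$ if $[\![t]\!]^\iota_m=[\![u]\!]^\iota_m$ for all $k$ with $k+m\le n$ and all equivariant $\iota\colon X\to A_k$. A $(T,n)$-model is a $(\Sigma,n)$-algebra satisfying every axiom in $E$. *)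

theory Defs
  imports
    Complex_Main
    "HOL-Combinatorics.Perm"
    "HOL-Library.Countable"
    "HOL-Library.Extended_Nat"
    "HOL-Library.Infinite_Typeclass"
begin

unbundle permutation_syntax

text \<open>
  The names are the elements of the type \<open>'n\<close>; the sort constraint
  \<open>'n::{countable,infinite}\<close> is imposed in the theorem. The group \<open>G\<close> is the library
  type \<open>'n perm\<close> of permutations that move only finitely many points.
\<close>

section \<open>Nominal sets\<close>

text \<open>
  The action is a total function on the carrier's type; it is constrained on the carrier only.
\<close>

record ('n, 'x) nomset =
  carrier :: "'x set"
  act :: "'n perm \<Rightarrow> 'x \<Rightarrow> 'x"

definition supports :: "('n, 'x) nomset \<Rightarrow> 'n set \<Rightarrow> 'x \<Rightarrow> bool" where
  "supports X S x \<longleftrightarrow> (\<forall>\<pi>. (\<forall>a\<in>S. \<pi> \<langle>$\<rangle> a = a) \<longrightarrow> act X \<pi> x = x)"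

definition nominal_set :: "('n, 'x) nomset \<Rightarrow> bool" where
  "nominal_set X \<longleftrightarrow>
     (\<forall>\<pi>. \<forall>x\<in>carrier X. act X \<pi> x \<in> carrier X) \<and>
     (\<forall>x\<in>carrier X. act X 1 x = x) \<and>
     (\<forall>\<pi> \<rho>. \<forall>x\<in>carrier X. act X (\<pi> * \<rho>) x = act X \<pi> (act X \<rho> x)) \<and>
     (\<forall>x\<in>carrier X. \<exists>S. finite S \<and> supports X S x)"

definition supp :: "('n, 'x) nomset \<Rightarrow> 'x \<Rightarrow> 'n set" where
  "supp X x = (LEAST S. finite S \<and> supports X S x)"

definition fresh :: "('n, 'x) nomset \<Rightarrow> 'n \<Rightarrow> 'x \<Rightarrow> bool" where
  "fresh X a x \<longleftrightarrow> a \<notin> supp X x"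

definition equivariant :: "('n, 'x) nomset \<Rightarrow> ('n, 'z) nomset \<Rightarrow> ('x \<Rightarrow> 'z) \<Rightarrow> bool" where
  "equivariant X Z f \<longleftrightarrow>
     (\<forall>x\<in>carrier X. f x \<in> carrier Z) \<and>
     (\<forall>\<pi>. \<forall>x\<in>carrier X. f (act X \<pi> x) = act Z \<pi> (f x))"

definition orbit_finite :: "('n, 'x) nomset \<Rightarrow> bool" where
  "orbit_finite X \<longleftrightarrow> finite ((\<lambda>x. range (\<lambda>\<pi>. act X \<pi> x)) ` carrier X)"

definition names :: "('n, 'n) nomset" where
  "names = \<lparr>carrier = UNIV, act = (\<lambda>\<pi> a. \<pi> \<langle>$\<rangle> a)\<rparr>"

definition prod_nom :: "('n, 'x) nomset \<Rightarrow> ('n, 'z) nomset \<Rightarrow> ('n, 'x \<times> 'z) nomset" where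
  "prod_nom X Z =
     \<lparr>carrier = carrier X \<times> carrier Z, act = (\<lambda>\<pi> (x, z). (act X \<pi> x, act Z \<pi> z))\<rparr>"

text \<open>The power \<open>X\<^sup>p\<close>, with tuples represented as lists of length \<open>p\<close>.\<close>

definition power_nom :: "nat \<Rightarrow> ('n, 'x) nomset \<Rightarrow> ('n, 'x list) nomset" where
  "power_nom p X =
     \<lparr>carrier = {xs. length xs = p \<and> set xs \<subseteq> carrier X}, act = (\<lambda>\<pi>. map (act X \<pi>))\<rparr>"

definition abs_rel :: "('n, 'x) nomset \<Rightarrow> (('n \<times> 'x) \<times> ('n \<times> 'x)) set" where
  "abs_rel X = {((a, x), (b, y)). x \<in> carrier X \<and> y \<in> carrier X \<and>
     (\<exists>c. fresh names c a \<and> fresh names c b \<and> fresh X c x \<and> fresh X c y \<and>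
          act X \<langle>c \<leftrightarrow> a\<rangle> x = act X \<langle>c \<leftrightarrow> b\<rangle> y)}"

text \<open>The class \<open>\<langle>a\<rangle>x\<close>.\<close>

definition abs_class :: "('n, 'x) nomset \<Rightarrow> 'n \<Rightarrow> 'x \<Rightarrow> ('n \<times> 'x) set" where
  "abs_class X a x = abs_rel X `` {(a, x)}"

text \<open>
  The nominal set \<open>[\<A>]X\<close>. A permutation acts on a class elementwise; lemma \<open>act_abs_class\<close>
  below shows that this is \<open>\<pi> \<cdot> \<langle>a\<rangle>x = \<langle>\<pi>(a)\<rangle>(\<pi> \<cdot> x)\<close>.
\<close>

definition abs_nom :: "('n, 'x) nomset \<Rightarrow> ('n, ('n \<times> 'x) set) nomset" where
  "abs_nom X =
     \<lparr>carrier = carrier (prod_nom names X) // abs_rel X,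
      act = (\<lambda>\<pi> C. act (prod_nom names X) \<pi> ` C)\<rparr>"

lemma nominal_setD:
  assumes "nominal_set X" "x \<in> carrier X"
  shows "act X \<pi> x \<in> carrier X" "act X 1 x = x"
    "act X (\<pi> * \<rho>) x = act X \<pi> (act X \<rho> x)" "\<exists>S. finite S \<and> supports X S x"
  using assms by (simp_all add: nominal_set_def)

lemma act_inverse_act:
  assumes "nominal_set X" "x \<in> carrier X"
  shows "act X (inverse \<pi>) (act X \<pi> x) = x" "act X \<pi> (act X (inverse \<pi>) x) = x"
  by (simp_all add: nominal_setD(2)[OF assms] flip: nominal_setD(3)[OF assms])

lemma supports_Int:
  fixes X :: "('n::infinite, 'x) nomset"
  assumes X: "nominal_set X" "x \<in> carrier X"
    and S: "finite S" "supports X S x" and T: "finite T" "supports X T x"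
  shows "supports X (S \<inter> T) x"
proof -
  note D = nominal_setD[OF X]
  have sw: "act X \<langle>d \<leftrightarrow> c\<rangle> x = x" if "d \<notin> S \<inter> T" "c \<notin> S \<union> T" for c d
  proof (cases "d \<in> S")
    case True
    with that have "\<forall>a\<in>T. \<langle>d \<leftrightarrow> c\<rangle> \<langle>$\<rangle> a = a" by (metis IntI UnI2 apply_swap_same)
    then show ?thesis using T by (simp add: supports_def)
  next
    case False
    with that have "\<forall>a\<in>S. \<langle>d \<leftrightarrow> c\<rangle> \<langle>$\<rangle> a = a" by (metis UnI1 apply_swap_same)
    then show ?thesis using S by (simp add: supports_def)
  qed
  have sw2: "act X \<langle>a \<leftrightarrow> b\<rangle> x = x" if "a \<notin> S \<inter> T" "b \<notin> S \<inter> T" "a \<noteq> b" for a b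
  proof -
    obtain c where c: "c \<notin> S \<union> T \<union> {a, b}"
      using S T arb_element[of "S \<union> T \<union> {a, b}"] by auto
    have "\<langle>a \<leftrightarrow> b\<rangle> = \<langle>a \<leftrightarrow> c\<rangle> * (\<langle>b \<leftrightarrow> c\<rangle> * \<langle>a \<leftrightarrow> c\<rangle>)"
    proof (rule perm_eqI)
      fix d
      show "\<langle>a \<leftrightarrow> b\<rangle> \<langle>$\<rangle> d = (\<langle>a \<leftrightarrow> c\<rangle> * (\<langle>b \<leftrightarrow> c\<rangle> * \<langle>a \<leftrightarrow> c\<rangle>)) \<langle>$\<rangle> d"
        using c that by (cases "d = a"; cases "d = b"; cases "d = c") (auto simp: apply_times)
    qed
    then show ?thesis using sw[of a c] sw[of b c] c that by (simp add: D)
  qed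
  have "act X \<pi> x = x" if "\<forall>a\<in>S \<inter> T. \<pi> \<langle>$\<rangle> a = a" for \<pi>
    using that
  proof (induction "card (affected \<pi>)" arbitrary: \<pi> rule: less_induct)
    case less
    show ?case
    proof (cases "\<pi> = 1")
      case True
      then show ?thesis by (simp add: D)
    next
      case False
      then obtain a where a: "\<pi> \<langle>$\<rangle> a \<noteq> a"
        by (metis apply_one id_apply perm_eqI)
      define b where "b = \<pi> \<langle>$\<rangle> a"
      define \<rho> where "\<rho> = \<langle>a \<leftrightarrow> b\<rangle> * \<pi>"
      have ab: "a \<noteq> b" "\<pi> \<langle>$\<rangle> b \<noteq> b" using a by (auto simp: b_def apply_inj)
      have \<rho>: "\<rho> \<langle>$\<rangle> d = d" if "\<pi> \<langle>$\<rangle> d = d" for d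
        using that ab a by (metis \<rho>_def apply_sequence apply_swap_same)
      have "\<rho> \<langle>$\<rangle> a = a" by (simp add: \<rho>_def b_def apply_times)
      then have "affected \<rho> \<subset> affected \<pi>"
        using \<rho> a by (auto simp: in_affected)
      then have "card (affected \<rho>) < card (affected \<pi>)" by (simp add: psubset_card_mono)
      then have "act X \<rho> x = x" using less \<rho> by blast
      moreover have "\<pi> = \<langle>a \<leftrightarrow> b\<rangle> * \<rho>" by (simp add: \<rho>_def flip: mult.assoc)
      moreover have "act X \<langle>a \<leftrightarrow> b\<rangle> x = x"
        using sw2[of a b] a ab less.prems by blast
      ultimately show ?thesis by (simp add: D)
    qed
  qed
  then show ?thesis by (simp add: supports_def)
qed

lemma supp_least:
  fixes X :: "('n::infinite, 'x) nomset"
  assumes X: "nominal_set X" "x \<in> carrier X"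
  shows "finite (supp X x)" "supports X (supp X x) x"
    "\<And>T. finite T \<Longrightarrow> supports X T x \<Longrightarrow> supp X x \<subseteq> T"
proof -
  obtain S where S: "finite S" "supports X S x"
    and min: "\<And>T. finite T \<and> supports X T x \<Longrightarrow> card S \<le> card T"
    using ex_has_least_nat[of "\<lambda>S. finite S \<and> supports X S x" _ card] nominal_setD(4)[OF X]
    by blast
  have le: "S \<subseteq> T" if T: "finite T" "supports X T x" for T
  proof -
    have "card S \<le> card (S \<inter> T)"
      using supports_Int[OF X S T] S min by blast
    then have "S \<inter> T = S" using S by (metis card_seteq inf_le1)
    then show ?thesis by blast
  qed
  have "supp X x = S"
    unfolding supp_def using S le by (intro Least_equality) auto
  then show "finite (supp X x)" "supports X (supp X x) x"
    "\<And>T. finite T \<Longrightarrow> supports X T x \<Longrightarrow> supp X x \<subseteq> T"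
    using S le by auto
qed

lemma supports_act:
  assumes X: "nominal_set X" "x \<in> carrier X" and S: "supports X S x"
  shows "supports X (apply \<pi> ` S) (act X \<pi> x)"
  unfolding supports_def
proof (intro allI impI)
  note D = nominal_setD[OF X]
  fix \<rho> assume \<rho>: "\<forall>a\<in>apply \<pi> ` S. \<rho> \<langle>$\<rangle> a = a"
  have "(inverse \<pi> * (\<rho> * \<pi>)) \<langle>$\<rangle> a = a" if "a \<in> S" for a
  proof -
    have "(inverse \<pi> * (\<rho> * \<pi>)) \<langle>$\<rangle> a = (inverse \<pi> * \<pi>) \<langle>$\<rangle> a"
      using \<rho> that by (simp only: apply_times o_apply) simp
    then show ?thesis by simp
  qed
  then have "act X (inverse \<pi> * (\<rho> * \<pi>)) x = x"
    using S by (simp add: supports_def)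
  then have "act X (\<pi> * (inverse \<pi> * (\<rho> * \<pi>))) x = act X \<pi> x"
    by (simp only: D)
  moreover have "\<pi> * (inverse \<pi> * (\<rho> * \<pi>)) = \<rho> * \<pi>"
    by (simp flip: mult.assoc)
  ultimately show "act X \<rho> (act X \<pi> x) = act X \<pi> x"
    by (simp add: D)
qed

lemma fresh_act:
  fixes X :: "('n::infinite, 'x) nomset"
  assumes X: "nominal_set X" "x \<in> carrier X" and c: "fresh X c x"
  shows "fresh X (\<pi> \<langle>$\<rangle> c) (act X \<pi> x)"
proof -
  note D = nominal_setD[OF X]
  have "supports X (apply \<pi> ` supp X x) (act X \<pi> x)"
    by (intro supports_act X supp_least)
  then have "supp X (act X \<pi> x) \<subseteq> apply \<pi> ` supp X x"
    by (intro supp_least X D finite_imageI)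
  then show ?thesis using c by (auto simp: fresh_def apply_inj)
qed

lemma nominal_set_names: "nominal_set names"
proof -
  have "supports names {a} a" for a :: 'a
    by (simp add: supports_def names_def)
  then have "\<exists>S. finite S \<and> supports names S a" for a :: 'a
    by blast
  then show ?thesis by (simp add: nominal_set_def names_def apply_times)
qed

lemma abs_rel_act:
  fixes X :: "('n::infinite, 'x) nomset"
  assumes X: "nominal_set X" and r: "((a, x), (b, y)) \<in> abs_rel X"
  shows "((\<pi> \<langle>$\<rangle> a, act X \<pi> x), (\<pi> \<langle>$\<rangle> b, act X \<pi> y)) \<in> abs_rel X"
proof -
  from r obtain c where xy: "x \<in> carrier X" "y \<in> carrier X"
    and c: "fresh names c a" "fresh names c b" "fresh X c x" "fresh X c y"
    and eq: "act X \<langle>c \<leftrightarrow> a\<rangle> x = act X \<langle>c \<leftrightarrow> b\<rangle> y"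
    by (auto simp: abs_rel_def)
  have sw: "\<langle>\<pi> \<langle>$\<rangle> c \<leftrightarrow> \<pi> \<langle>$\<rangle> d\<rangle> * \<pi> = \<pi> * \<langle>c \<leftrightarrow> d\<rangle>" for d
  proof (rule perm_eqI)
    fix e
    show "(\<langle>\<pi> \<langle>$\<rangle> c \<leftrightarrow> \<pi> \<langle>$\<rangle> d\<rangle> * \<pi>) \<langle>$\<rangle> e = (\<pi> * \<langle>c \<leftrightarrow> d\<rangle>) \<langle>$\<rangle> e"
      by (cases "e = c"; cases "e = d") (auto simp: apply_times apply_inj)
  qed
  have fr: "fresh names (\<pi> \<langle>$\<rangle> c) (\<pi> \<langle>$\<rangle> d)" if "fresh names c d" for d
    using fresh_act[OF nominal_set_names _ that, of \<pi>] by (simp add: names_def)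
  have "act X \<langle>\<pi> \<langle>$\<rangle> c \<leftrightarrow> \<pi> \<langle>$\<rangle> a\<rangle> (act X \<pi> x) = act X \<langle>\<pi> \<langle>$\<rangle> c \<leftrightarrow> \<pi> \<langle>$\<rangle> b\<rangle> (act X \<pi> y)"
    using eq by (simp add: sw nominal_setD(3)[OF X] xy flip: nominal_setD(3)[OF X])
      (simp add: nominal_setD(3)[OF X] xy)
  then show ?thesis
    using fresh_act[OF X xy(1) c(3)] fresh_act[OF X xy(2) c(4)] fr[OF c(1)] fr[OF c(2)]
      nominal_setD(1)[OF X] xy
    unfolding abs_rel_def by blast
qed

lemma act_abs_class:
  fixes X :: "('n::infinite, 'x) nomset"
  assumes X: "nominal_set X" "x \<in> carrier X"
  shows "act (abs_nom X) \<pi> (abs_class X a x) = abs_class X (\<pi> \<langle>$\<rangle> a) (act X \<pi> x)"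
    (is "?L = ?R")
proof
  show "?L \<subseteq> ?R"
    using abs_rel_act[OF X(1)] by (auto simp: abs_nom_def abs_class_def prod_nom_def names_def)
  show "?R \<subseteq> ?L"
  proof
    fix q assume "q \<in> ?R"
    then obtain b y where q: "q = (b, y)"
      and r: "((\<pi> \<langle>$\<rangle> a, act X \<pi> x), (b, y)) \<in> abs_rel X"
      by (cases q) (auto simp: abs_class_def)
    have y: "y \<in> carrier X" using r by (simp add: abs_rel_def)
    have inv: "inverse \<pi> \<langle>$\<rangle> (\<pi> \<langle>$\<rangle> a) = a" "\<pi> \<langle>$\<rangle> (inverse \<pi> \<langle>$\<rangle> b) = b"
      by (simp_all add: apply_sequence)
    have "((a, x), (inverse \<pi> \<langle>$\<rangle> b, act X (inverse \<pi>) y)) \<in> abs_rel X"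
      using abs_rel_act[OF X(1) r, of "inverse \<pi>"] act_inverse_act[OF X] inv by simp
    then show "q \<in> ?L"
      using act_inverse_act[OF X(1) y] inv q
      by (auto simp: abs_nom_def abs_class_def prod_nom_def names_def intro!: rev_image_eqI)
  qed
qed

section \<open>Signatures and terms\<close>

record 'f signature =
  pure_ops :: "'f set"
  free_ops :: "'f set"
  bound_ops :: "'f set"
  ar :: "'f \<Rightarrow> nat"
  dep :: "'f \<Rightarrow> nat"

definition graded_signature :: "'f signature \<Rightarrow> bool" where
  "graded_signature \<Sigma> \<longleftrightarrow>
     pure_ops \<Sigma> \<inter> free_ops \<Sigma> = {} \<and>
     pure_ops \<Sigma> \<inter> bound_ops \<Sigma> = {} \<and>
     free_ops \<Sigma> \<inter> bound_ops \<Sigma> = {}"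

text \<open>The prefixes \<open>\<eta>\<close>: empty, \<open>a\<close>, and \<open>\<nu>a\<close>.\<close>

datatype 'n prefix = NoName | FreeName 'n | BoundName 'n

datatype ('n, 'f, 'x) trm = Var 'x | Op "'n prefix" 'f "('n, 'f, 'x) trm list"

fun admissible :: "'f signature \<Rightarrow> 'n prefix \<Rightarrow> 'f \<Rightarrow> bool" where
  "admissible \<Sigma> NoName f \<longleftrightarrow> f \<in> pure_ops \<Sigma>"
| "admissible \<Sigma> (FreeName a) f \<longleftrightarrow> f \<in> free_ops \<Sigma>"
| "admissible \<Sigma> (BoundName a) f \<longleftrightarrow> f \<in> bound_ops \<Sigma>"

text \<open>
  \<open>has_depth \<Sigma> V m t\<close>: \<open>t\<close> is a \<open>\<Sigma>\<close>-term over the variables \<open>V\<close> and has uniform depth \<open>m\<close>.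
  Depth need not be unique: a constant \<open>f\<close> has every depth \<open>m + dep \<Sigma> f\<close>.
\<close>

inductive has_depth :: "'f signature \<Rightarrow> 'x set \<Rightarrow> nat \<Rightarrow> ('n, 'f, 'x) trm \<Rightarrow> bool"
  for \<Sigma> :: "'f signature" and V :: "'x set" where
  "x \<in> V \<Longrightarrow> has_depth \<Sigma> V 0 (Var x)"
| "admissible \<Sigma> \<eta> f \<Longrightarrow> length ts = ar \<Sigma> f \<Longrightarrow> \<forall>t\<in>set ts. has_depth \<Sigma> V m t \<Longrightarrow>
     has_depth \<Sigma> V (m + dep \<Sigma> f) (Op \<eta> f ts)"

fun act_prefix :: "'n perm \<Rightarrow> 'n prefix \<Rightarrow> 'n prefix" where
  "act_prefix \<pi> NoName = NoName"
| "act_prefix \<pi> (FreeName a) = FreeName (\<pi> \<langle>$\<rangle> a)"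
| "act_prefix \<pi> (BoundName a) = BoundName (\<pi> \<langle>$\<rangle> a)"

fun act_trm :: "('n, 'x) nomset \<Rightarrow> 'n perm \<Rightarrow> ('n, 'f, 'x) trm \<Rightarrow> ('n, 'f, 'x) trm" where
  "act_trm X \<pi> (Var x) = Var (act X \<pi> x)"
| "act_trm X \<pi> (Op \<eta> f ts) = Op (act_prefix \<pi> \<eta>) f (map (act_trm X \<pi>) ts)"

definition Term ::
    "'f signature \<Rightarrow> nat \<Rightarrow> ('n, 'x) nomset \<Rightarrow> ('n, ('n, 'f, 'x) trm) nomset" where
  "Term \<Sigma> m X = \<lparr>carrier = {t. has_depth \<Sigma> (carrier X) m t}, act = act_trm X\<rparr>"

fun subst :: "('y \<Rightarrow> ('n, 'f, 'x) trm) \<Rightarrow> ('n, 'f, 'y) trm \<Rightarrow> ('n, 'f, 'x) trm" where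
  "subst \<sigma> (Var y) = \<sigma> y"
| "subst \<sigma> (Op \<eta> f ts) = Op \<eta> f (map (subst \<sigma>) ts)"

section \<open>Theories and derivations\<close>

record ('n, 'f, 'y) equation =
  ctxt :: "('n, 'y) nomset"
  eq_depth :: nat
  lhs :: "('n, 'f, 'y) trm"
  rhs :: "('n, 'f, 'y) trm"

definition is_equation :: "'f signature \<Rightarrow> ('n, 'f, 'y) equation \<Rightarrow> bool" where
  "is_equation \<Sigma> e \<longleftrightarrow>
     nominal_set (ctxt e) \<and> orbit_finite (ctxt e) \<and>
     lhs e \<in> carrier (Term \<Sigma> (eq_depth e) (ctxt e)) \<and>
     rhs e \<in> carrier (Term \<Sigma> (eq_depth e) (ctxt e))"

text \<open>
  The contexts of the axioms are arbitrary nominal sets carried by subsets of the type \<open>'y\<close>,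
  and may differ from axiom to axiom.
\<close>

record ('n, 'f, 'y) theory_pres =
  sig :: "'f signature"
  axioms :: "('n, 'f, 'y) equation set"

definition graded_theory :: "('n, 'f, 'y) theory_pres \<Rightarrow> bool" where
  "graded_theory T \<longleftrightarrow> graded_signature (sig T) \<and> (\<forall>e\<in>axioms T. is_equation (sig T) e)"

text \<open>
  In rule \<open>deriv_perm\<close> membership of the \<open>u\<^sub>i\<close> in the term set is stated explicitly, since it is not
  implied by that of \<open>(a b) \<cdot> u\<^sub>i\<close>: the action of \<open>X\<close> is unconstrained off the carrier.
\<close>

inductive derivable ::
    "('n, 'f, 'y) theory_pres \<Rightarrow> ('n, 'x) nomset \<Rightarrow> nat \<Rightarrow>
     ('n, 'f, 'x) trm \<Rightarrow> ('n, 'f, 'x) trm \<Rightarrow> bool"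
  for T :: "('n, 'f, 'y) theory_pres" and X :: "('n, 'x) nomset" where
  deriv_refl: "x \<in> carrier X \<Longrightarrow> derivable T X 0 (Var x) (Var x)"
| deriv_symm: "derivable T X m u t \<Longrightarrow> derivable T X m t u"
| deriv_trans: "derivable T X m t v \<Longrightarrow> derivable T X m v u \<Longrightarrow> derivable T X m t u"
| deriv_cong: "admissible (sig T) \<eta> f \<Longrightarrow>
     length ts = ar (sig T) f \<Longrightarrow> length us = ar (sig T) f \<Longrightarrow>
     \<forall>i<ar (sig T) f. derivable T X m (ts ! i) (us ! i) \<Longrightarrow>
     derivable T X (m + dep (sig T) f) (Op \<eta> f ts) (Op \<eta> f us)"
| deriv_ax: "e \<in> axioms T \<Longrightarrow>
     \<forall>y\<in>carrier (ctxt e). \<sigma> y \<in> carrier (Term (sig T) l X) \<Longrightarrow>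
     \<forall>\<pi>. \<forall>y\<in>carrier (ctxt e).
       derivable T X l (act (Term (sig T) l X) \<pi> (\<sigma> y)) (\<sigma> (act (ctxt e) \<pi> y)) \<Longrightarrow>
     derivable T X (eq_depth e + l)
       (subst \<sigma> (act (Term (sig T) (eq_depth e) (ctxt e)) \<tau> (lhs e)))
       (subst \<sigma> (act (Term (sig T) (eq_depth e) (ctxt e)) \<tau> (rhs e)))"
| deriv_perm: "h \<in> bound_ops (sig T) \<Longrightarrow> a \<noteq> b \<Longrightarrow>
     length ts = ar (sig T) h \<Longrightarrow> length us = ar (sig T) h \<Longrightarrow>
     \<forall>i<ar (sig T) h. us ! i \<in> carrier (Term (sig T) m X) \<and> fresh (Term (sig T) m X) a (us ! i) \<Longrightarrow>
     \<forall>i<ar (sig T) h.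
       derivable T X m (ts ! i) (act (Term (sig T) m X) \<langle>a \<leftrightarrow> b\<rangle> (us ! i)) \<Longrightarrow>
     derivable T X (m + dep (sig T) h) (Op (BoundName a) h ts) (Op (BoundName b) h us)"

section \<open>Algebras and models\<close>

text \<open>
  The bound \<open>n \<le> \<omega>\<close> is an extended natural number; the levels are the \<open>i\<close> with \<open>enat i \<le> n\<close>,
  i.e. all natural numbers if \<open>n = \<infinity>\<close>. Levels above \<open>n\<close> and operations into
  them are junk values of the record.
\<close>

record ('n, 'f, 'c) algebra =
  lev :: "nat \<Rightarrow> ('n, 'c) nomset"
  pure_op :: "'f \<Rightarrow> nat \<Rightarrow> 'c list \<Rightarrow> 'c"
  free_op :: "'f \<Rightarrow> nat \<Rightarrow> 'n \<times> 'c list \<Rightarrow> 'c"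
  bound_op :: "'f \<Rightarrow> nat \<Rightarrow> ('n \<times> 'c list) set \<Rightarrow> 'c"

definition nominal_algebra :: "'f signature \<Rightarrow> enat \<Rightarrow> ('n, 'f, 'c) algebra \<Rightarrow> bool" where
  "nominal_algebra \<Sigma> n A \<longleftrightarrow>
     (\<forall>i. enat i \<le> n \<longrightarrow> nominal_set (lev A i)) \<and>
     (\<forall>f\<in>pure_ops \<Sigma>. \<forall>m. enat (m + dep \<Sigma> f) \<le> n \<longrightarrow>
        equivariant (power_nom (ar \<Sigma> f) (lev A m)) (lev A (m + dep \<Sigma> f)) (pure_op A f m)) \<and>
     (\<forall>f\<in>free_ops \<Sigma>. \<forall>m. enat (m + dep \<Sigma> f) \<le> n \<longrightarrow>
        equivariant (prod_nom names (power_nom (ar \<Sigma> f) (lev A m)))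
          (lev A (m + dep \<Sigma> f)) (free_op A f m)) \<and>
     (\<forall>f\<in>bound_ops \<Sigma>. \<forall>m. enat (m + dep \<Sigma> f) \<le> n \<longrightarrow>
        equivariant (abs_nom (power_nom (ar \<Sigma> f) (lev A m)))
          (lev A (m + dep \<Sigma> f)) (bound_op A f m))"

fun interp :: "'f signature \<Rightarrow> ('n, 'f, 'c) algebra \<Rightarrow> 'n prefix \<Rightarrow> 'f \<Rightarrow> nat \<Rightarrow> 'c list \<Rightarrow> 'c" where
  "interp \<Sigma> A NoName f m vs = pure_op A f m vs"
| "interp \<Sigma> A (FreeName a) f m vs = free_op A f m (a, vs)"
| "interp \<Sigma> A (BoundName a) f m vs =
     bound_op A f m (abs_class (power_nom (ar \<Sigma> f) (lev A m)) a vs)"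

text \<open>
  The argument \<open>d\<close> is the uniform depth at which the term is evaluated, so the arguments of \<open>f\<close> are
  evaluated at depth \<open>d - dep \<Sigma> f\<close>; on terms of uniform depth \<open>d\<close> the subtraction
  does not truncate (lemma \<open>eval_Op\<close> gives the equation without it).
\<close>

fun eval :: "'f signature \<Rightarrow> ('n, 'f, 'c) algebra \<Rightarrow> nat \<Rightarrow> ('x \<Rightarrow> 'c) \<Rightarrow> nat \<Rightarrow>
    ('n, 'f, 'x) trm \<Rightarrow> 'c" where
  "eval \<Sigma> A k \<iota> d (Var x) = \<iota> x"
| "eval \<Sigma> A k \<iota> d (Op \<eta> f ts) =
     interp \<Sigma> A \<eta> f (k + (d - dep \<Sigma> f)) (map (eval \<Sigma> A k \<iota> (d - dep \<Sigma> f)) ts)"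

lemma eval_Op:
  "eval \<Sigma> A k \<iota> (m + dep \<Sigma> f) (Op \<eta> f ts) = interp \<Sigma> A \<eta> f (k + m) (map (eval \<Sigma> A k \<iota> m) ts)"
  by simp

definition satisfies ::
    "'f signature \<Rightarrow> enat \<Rightarrow> ('n, 'f, 'c) algebra \<Rightarrow> ('n, 'x) nomset \<Rightarrow> nat \<Rightarrow>
     ('n, 'f, 'x) trm \<Rightarrow> ('n, 'f, 'x) trm \<Rightarrow> bool" where
  "satisfies \<Sigma> n A X m t u \<longleftrightarrow>
     (\<forall>k \<iota>. enat (k + m) \<le> n \<and> equivariant X (lev A k) \<iota> \<longrightarrow>
        eval \<Sigma> A k \<iota> m t = eval \<Sigma> A k \<iota> m u)"

definition model :: "('n, 'f, 'y) theory_pres \<Rightarrow> enat \<Rightarrow> ('n, 'f, 'c) algebra \<Rightarrow> bool" where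
  "model T n A \<longleftrightarrow>
     nominal_algebra (sig T) n A \<and>
     (\<forall>e\<in>axioms T. satisfies (sig T) n A (ctxt e) (eq_depth e) (lhs e) (rhs e))"

end

theory Submission
  imports Defs
begin

text \<open>
  Induction on the derivation, for all levels and valuations at once. Evaluation is an equivariant
  map on terms of fixed depth. In the axiom rule, \<open>y \<mapsto> \<lbrakk>\<sigma>(y)\<rbrakk>\<close> is therefore an equivariant valuation
  into a higher level, precisely because the equivariance of \<open>\<sigma>\<close> up to derivability is a
  premise to which the induction hypothesis applies; the substitution lemma then reduces the
  claim to the axiom. In the permutation rule, equivariant maps preserve freshness, so the
  values satisfy \<open>\<langle>a\<rangle>((a b) \<cdot> x) = \<langle>b\<rangle>x\<close> with \<open>a\<close> fresh for \<open>x\<close>.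
\<close>

section \<open>Freshness\<close>

text \<open>Turns the freshness conditions on names in \<open>abs_rel\<close> into inequalities. The
  empty set cannot support a name, since a swap with any second name moves it.\<close>

lemma fresh_names_iff: "fresh names c a \<longleftrightarrow> c \<noteq> a" for a c :: "'n::infinite"
proof -
  have a: "a \<in> carrier names" by (simp add: names_def)
  note L = supp_least[OF nominal_set_names a]
  have "supports names {a} a" by (simp add: supports_def names_def)
  then have sub: "supp names a \<subseteq> {a}" by (intro L) auto
  obtain b where b: "b \<noteq> a" using arb_element[of "{a}"] by auto
  have "a \<in> supp names a"
  proof (rule ccontr)
    assume "a \<notin> supp names a"
    then have "supp names a = {}" using sub by blast
    then have "act names \<langle>a \<leftrightarrow> b\<rangle> a = a" using L(2) by (simp add: supports_def)
    then show False using b by (simp add: names_def)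
  qed
  then show ?thesis using sub by (auto simp: fresh_def)
qed

lemma not_fresh_finite:
  fixes X :: "('n::infinite, 'x) nomset"
  assumes "nominal_set X" "x \<in> carrier X"
  shows "finite {c. \<not> fresh X c x}"
  using supp_least(1)[OF assms] by (simp add: fresh_def)

lemma act_swap_fresh:
  fixes X :: "('n::infinite, 'x) nomset"
  assumes X: "nominal_set X" "x \<in> carrier X" and "fresh X a x" "fresh X b x"
  shows "act X \<langle>a \<leftrightarrow> b\<rangle> x = x"
proof -
  have "\<forall>c\<in>supp X x. \<langle>a \<leftrightarrow> b\<rangle> \<langle>$\<rangle> c = c"
    using assms(3,4) by (metis apply_swap_same fresh_def)
  then show ?thesis using supp_least(2)[OF X] by (simp add: supports_def)
qed

text \<open>Every permutation fixing \<open>x\<close> fixes \<open>f x\<close>, so the support of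
  \<open>x\<close> also supports \<open>f x\<close>, and the least support of \<open>f x\<close>
  lies inside it.\<close>

lemma fresh_equivariant:
  fixes X :: "('n::infinite, 'x) nomset"
  assumes X: "nominal_set X" and Z: "nominal_set Z" and f: "equivariant X Z f"
    and x: "x \<in> carrier X" and a: "fresh X a x"
  shows "fresh Z a (f x)"
proof -
  have fx: "f x \<in> carrier Z" using f x by (simp add: equivariant_def)
  have "supports Z (supp X x) (f x)"
    using supp_least(2)[OF X x] f x unfolding supports_def equivariant_def by metis
  then have "supp Z (f x) \<subseteq> supp X x"
    by (intro supp_least Z fx X x)
  then show ?thesis using a by (auto simp: fresh_def)
qed

text \<open>Stated for an arbitrary \<open>f\<close> so that it serves both tuples over a nominal
  set and argument lists of terms, where finite support is known only as an induction
  hypothesis.\<close>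

lemma finite_supports_list:
  assumes "\<forall>x\<in>set xs. \<exists>S. finite S \<and> (\<forall>\<pi>. (\<forall>a\<in>S. \<pi> \<langle>$\<rangle> a = a) \<longrightarrow> f \<pi> x = x)"
  shows "\<exists>S. finite S \<and> (\<forall>\<pi>. (\<forall>a\<in>S. \<pi> \<langle>$\<rangle> a = a) \<longrightarrow> map (f \<pi>) xs = xs)"
proof -
  obtain S where S: "\<forall>x\<in>set xs. finite (S x) \<and> (\<forall>\<pi>. (\<forall>a\<in>S x. \<pi> \<langle>$\<rangle> a = a) \<longrightarrow> f \<pi> x = x)"
    using assms by metis
  then show ?thesis
    by (intro exI[of _ "\<Union>x\<in>set xs. S x"]) (auto intro!: map_idI)
qed

lemma nominal_set_power_nom:
  assumes X: "nominal_set X"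
  shows "nominal_set (power_nom p X)"
proof -
  have "\<exists>S. finite S \<and> supports (power_nom p X) S xs" if "set xs \<subseteq> carrier X" for xs
    using finite_supports_list[of xs "act X"] nominal_setD(4)[OF X] that
    by (force simp: supports_def power_nom_def)
  then show ?thesis
    using nominal_setD(1-3)[OF X]
    by (auto simp: nominal_set_def power_nom_def subset_iff intro!: map_idI)
qed

text \<open>The union of the supports of the entries supports the tuple. The permutation rule gives
  freshness argument by argument, whereas abstraction is over the whole tuple.\<close>

lemma fresh_power_nom:
  fixes X :: "('n::infinite, 'x) nomset"
  assumes X: "nominal_set X" and xs: "xs \<in> carrier (power_nom p X)"
    and a: "\<forall>x\<in>set xs. fresh X a x"
  shows "fresh (power_nom p X) a xs"
proof -
  have c: "x \<in> carrier X" if "x \<in> set xs" for x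
    using xs that by (auto simp: power_nom_def)
  let ?S = "\<Union>x\<in>set xs. supp X x"
  have "supports (power_nom p X) ?S xs"
    using supp_least(2)[OF X c] by (fastforce simp: supports_def power_nom_def intro!: map_idI)
  moreover have "finite ?S" using supp_least(1)[OF X c] by auto
  ultimately have "supp (power_nom p X) xs \<subseteq> ?S"
    by (intro supp_least nominal_set_power_nom X xs)
  then show ?thesis using a by (auto simp: fresh_def)
qed

section \<open>Name abstraction\<close>

text \<open>Conjugation by (c e) carries (e a) to (c a), because it sends e to c and leaves a
  alone.\<close>

lemma swap_mult_swap:
  assumes "e \<noteq> a" "c \<noteq> a"
  shows "\<langle>c \<leftrightarrow> e\<rangle> * \<langle>e \<leftrightarrow> a\<rangle> = \<langle>c \<leftrightarrow> a\<rangle> * \<langle>c \<leftrightarrow> e\<rangle>"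
proof (rule perm_eqI)
  fix d
  show "(\<langle>c \<leftrightarrow> e\<rangle> * \<langle>e \<leftrightarrow> a\<rangle>) \<langle>$\<rangle> d = (\<langle>c \<leftrightarrow> a\<rangle> * \<langle>c \<leftrightarrow> e\<rangle>) \<langle>$\<rangle> d"
    using assms by (cases "d = a"; cases "d = c"; cases "d = e") (auto simp: apply_times)
qed

text \<open>The \<open>some/any\<close> property of the fresh name in the definition of the abstraction relation.\<close>

lemma abs_rel_any:
  fixes X :: "('n::infinite, 'x) nomset"
  assumes X: "nominal_set X" and r: "((a, x), (b, y)) \<in> abs_rel X"
    and c: "c \<noteq> a" "c \<noteq> b" "fresh X c x" "fresh X c y"
  shows "act X \<langle>c \<leftrightarrow> a\<rangle> x = act X \<langle>c \<leftrightarrow> b\<rangle> y"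
proof -
  from r obtain e where xy: "x \<in> carrier X" "y \<in> carrier X"
    and e: "e \<noteq> a" "e \<noteq> b" "fresh X e x" "fresh X e y"
    and eq: "act X \<langle>e \<leftrightarrow> a\<rangle> x = act X \<langle>e \<leftrightarrow> b\<rangle> y"
    by (auto simp: abs_rel_def fresh_names_iff)
  \<comment> \<open>Both c and e are fresh for z, so (c e) fixes z and conjugation replaces e by c.
    Used on both sides of \<open>eq\<close>, this changes the witness from e to c.\<close>
  have *: "act X \<langle>c \<leftrightarrow> d\<rangle> z = act X \<langle>c \<leftrightarrow> e\<rangle> (act X \<langle>e \<leftrightarrow> d\<rangle> z)"
    if "z \<in> carrier X" "c \<noteq> d" "e \<noteq> d" "fresh X c z" "fresh X e z" for d z
    using that act_swap_fresh[OF X that(1), of c e]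
    by (metis nominal_setD(3)[OF X] swap_mult_swap)
  show ?thesis using *[of x a] *[of y b] xy c e eq by simp
qed

lemma abs_class_swap_subset:
  fixes X :: "('n::infinite, 'x) nomset"
  assumes X: "nominal_set X" and x: "x \<in> carrier X" and a: "a \<noteq> b" "fresh X a x"
  shows "abs_class X b x \<subseteq> abs_class X a (act X \<langle>a \<leftrightarrow> b\<rangle> x)"
proof
  fix q assume "q \<in> abs_class X b x"
  then obtain d z where q: "q = (d, z)" and r: "((b, x), (d, z)) \<in> abs_rel X"
    by (cases q) (auto simp: abs_class_def)
  have z: "z \<in> carrier X" using r by (simp add: abs_rel_def)
  have fin: "finite ({a, b, d} \<union> {c. \<not> fresh X c x} \<union> {c. \<not> fresh X c z})"
    using not_fresh_finite[OF X x] not_fresh_finite[OF X z] by simp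
  \<comment> \<open>One name fresh for everything in sight serves twice: \<open>abs_rel_any\<close>
    accepts it for the given pair, and it is the witness for the new pair.\<close>
  obtain c where c: "c \<noteq> a" "c \<noteq> b" "c \<noteq> d" "fresh X c x" "fresh X c z"
    using arb_element[OF fin] by blast
  have "fresh X c (act X \<langle>a \<leftrightarrow> b\<rangle> x)"
    using fresh_act[OF X x c(4), of "\<langle>a \<leftrightarrow> b\<rangle>"] c by simp
  moreover have "act X \<langle>c \<leftrightarrow> a\<rangle> (act X \<langle>a \<leftrightarrow> b\<rangle> x) = act X \<langle>c \<leftrightarrow> d\<rangle> z"
  proof -
    \<comment> \<open>Conjugation brings (c a) next to x, where it acts trivially since c and a are
      both fresh for x.\<close>
    have "act X \<langle>c \<leftrightarrow> a\<rangle> (act X \<langle>a \<leftrightarrow> b\<rangle> x) = act X \<langle>c \<leftrightarrow> b\<rangle> (act X \<langle>c \<leftrightarrow> a\<rangle> x)"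
      using swap_mult_swap[of a b c] a c by (simp flip: nominal_setD(3)[OF X x])
    also have "\<dots> = act X \<langle>c \<leftrightarrow> d\<rangle> z"
      using abs_rel_any[OF X r] c a act_swap_fresh[OF X x] by simp
    finally show ?thesis .
  qed
  ultimately show "q \<in> abs_class X a (act X \<langle>a \<leftrightarrow> b\<rangle> x)"
    using c x z nominal_setD(1)[OF X x]
    by (auto simp: q abs_class_def abs_rel_def fresh_names_iff)
qed

text \<open>The semantic form of alpha-renaming that validates the permutation rule. The converse
  inclusion is the same lemma with a and b exchanged, taken at (a b) x: b is fresh there, and
  swapping again returns x.\<close>

lemma abs_class_swap:
  fixes X :: "('n::infinite, 'x) nomset"
  assumes X: "nominal_set X" and x: "x \<in> carrier X" and a: "a \<noteq> b" "fresh X a x"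
  shows "abs_class X a (act X \<langle>a \<leftrightarrow> b\<rangle> x) = abs_class X b x"
proof
  have "fresh X b (act X \<langle>a \<leftrightarrow> b\<rangle> x)"
    using fresh_act[OF X x a(2), of "\<langle>a \<leftrightarrow> b\<rangle>"] by simp
  moreover have "act X \<langle>b \<leftrightarrow> a\<rangle> (act X \<langle>a \<leftrightarrow> b\<rangle> x) = x"
    by (simp add: swap_sym[of b a] nominal_setD(2)[OF X x] flip: nominal_setD(3)[OF X x])
  ultimately show "abs_class X a (act X \<langle>a \<leftrightarrow> b\<rangle> x) \<subseteq> abs_class X b x"
    using abs_class_swap_subset[OF X nominal_setD(1)[OF X x], of b a "\<langle>a \<leftrightarrow> b\<rangle>"] a by simp
qed (rule abs_class_swap_subset[OF assms])

section \<open>Terms\<close>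

lemma act_prefix_one: "act_prefix 1 \<eta> = \<eta>"
  by (cases \<eta>) auto

lemma act_prefix_mult: "act_prefix (\<pi> * \<rho>) \<eta> = act_prefix \<pi> (act_prefix \<rho> \<eta>)"
  by (cases \<eta>) (auto simp: apply_times)

lemma admissible_act_prefix: "admissible \<Sigma> (act_prefix \<pi> \<eta>) f \<longleftrightarrow> admissible \<Sigma> \<eta> f"
  by (cases \<eta>) auto

lemma has_depth_act_trm:
  assumes X: "nominal_set X" and t: "has_depth \<Sigma> (carrier X) m t"
  shows "has_depth \<Sigma> (carrier X) m (act_trm X \<pi> t)"
  using t
  by induction (auto intro!: has_depth.intros simp: nominal_setD(1)[OF X] admissible_act_prefix)

lemma nominal_set_Term:
  assumes X: "nominal_set X"
  shows "nominal_set (Term \<Sigma> m X)"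
proof -
  have one: "act_trm X 1 t = t" if "has_depth \<Sigma> (carrier X) m t" for t :: "('a, 'c, 'b) trm"
    using that
    by induction (auto simp: nominal_setD(2)[OF X] act_prefix_one intro!: map_idI)
  have mult: "act_trm X (\<pi> * \<rho>) t = act_trm X \<pi> (act_trm X \<rho> t)"
    if "has_depth \<Sigma> (carrier X) m t" for \<pi> \<rho> and t :: "('a, 'c, 'b) trm"
    using that
    by induction (auto simp: nominal_setD(3)[OF X] act_prefix_mult)
  have fin: "\<exists>S. finite S \<and> (\<forall>\<pi>. (\<forall>a\<in>S. \<pi> \<langle>$\<rangle> a = a) \<longrightarrow> act_trm X \<pi> t = t)"
    if "has_depth \<Sigma> (carrier X) m t" for t :: "('a, 'c, 'b) trm"
    using that
  proof induction
    case (1 x)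
    then show ?case using nominal_setD(4)[OF X] by (simp add: supports_def)
  next
    case (2 \<eta> f ts m)
    then obtain S where S: "finite S"
      "\<forall>\<pi>. (\<forall>a\<in>S. \<pi> \<langle>$\<rangle> a = a) \<longrightarrow> map (act_trm X \<pi>) ts = ts"
      using finite_supports_list[of ts "act_trm X"] by blast
    \<comment> \<open>Terms are raw, so a bound name in the prefix counts towards the support just
      like a free one.\<close>
    obtain B where B: "finite B" "\<forall>\<pi>. (\<forall>a\<in>B. \<pi> \<langle>$\<rangle> a = a) \<longrightarrow> act_prefix \<pi> \<eta> = \<eta>"
      by (cases \<eta>) (auto intro: that[of "{}"] that[of "{_}"])
    show ?case using S B by (intro exI[of _ "S \<union> B"]) auto
  qed
  show ?thesis
    using has_depth_act_trm[OF X] one mult fin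
    by (auto simp: nominal_set_def Term_def supports_def)
qed

section \<open>Evaluation\<close>

lemma act_abs_class_power_nom:
  fixes X :: "('n::infinite, 'x) nomset"
  assumes "nominal_set X" "xs \<in> carrier (power_nom p X)"
  shows "act (abs_nom (power_nom p X)) \<pi> (abs_class (power_nom p X) a xs) =
    abs_class (power_nom p X) (\<pi> \<langle>$\<rangle> a) (map (act X \<pi>) xs)"
  using act_abs_class[OF nominal_set_power_nom[OF assms(1)] assms(2), of \<pi> a]
  by (simp add: power_nom_def)

lemma enat_add_leD: "enat (i + j) \<le> n \<Longrightarrow> enat i \<le> n"
  by (meson enat_ord_simps(1) le_add1 order_trans)

text \<open>Each prefix reduces to equivariance of the corresponding operation. The bound case also
  needs that the elementwise action on a class yields the class of the permuted
  representative.\<close>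

lemma interp_equivariant:
  fixes A :: "('n::infinite, 'f, 'c) algebra"
  assumes A: "nominal_algebra \<Sigma> n A" and f: "admissible \<Sigma> \<eta> f"
    and n: "enat (j + dep \<Sigma> f) \<le> n"
    and vs: "length vs = ar \<Sigma> f" "set vs \<subseteq> carrier (lev A j)"
  shows "interp \<Sigma> A \<eta> f j vs \<in> carrier (lev A (j + dep \<Sigma> f))"
    and "interp \<Sigma> A (act_prefix \<pi> \<eta>) f j (map (act (lev A j) \<pi>) vs) =
      act (lev A (j + dep \<Sigma> f)) \<pi> (interp \<Sigma> A \<eta> f j vs)"
proof -
  let ?P = "power_nom (ar \<Sigma> f) (lev A j)"
  have "enat j \<le> n" using n by (rule enat_add_leD)
  then have L: "nominal_set (lev A j)" using A by (simp add: nominal_algebra_def)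
  have P: "vs \<in> carrier ?P" using vs by (simp add: power_nom_def)
  have act: "act ?P \<pi> vs = map (act (lev A j) \<pi>) vs" by (simp add: power_nom_def)
  have "interp \<Sigma> A \<eta> f j vs \<in> carrier (lev A (j + dep \<Sigma> f)) \<and>
    interp \<Sigma> A (act_prefix \<pi> \<eta>) f j (map (act (lev A j) \<pi>) vs) =
      act (lev A (j + dep \<Sigma> f)) \<pi> (interp \<Sigma> A \<eta> f j vs)"
  proof (cases \<eta>)
    case NoName
    then have "equivariant ?P (lev A (j + dep \<Sigma> f)) (pure_op A f j)"
      using A f n by (simp add: nominal_algebra_def)
    then show ?thesis using P NoName act by (simp add: equivariant_def) metis
  next
    case (FreeName a)
    then have "equivariant (prod_nom names ?P) (lev A (j + dep \<Sigma> f)) (free_op A f j)"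
      using A f n by (simp add: nominal_algebra_def)
    moreover have "(a, vs) \<in> carrier (prod_nom names ?P)"
      using P by (simp add: prod_nom_def names_def)
    moreover have "act (prod_nom names ?P) \<pi> (a, vs) = (\<pi> \<langle>$\<rangle> a, map (act (lev A j) \<pi>) vs)"
      using act by (simp add: prod_nom_def names_def)
    ultimately show ?thesis using FreeName
      unfolding equivariant_def by (metis act_prefix.simps(2) interp.simps(2))
  next
    case (BoundName a)
    then have "equivariant (abs_nom ?P) (lev A (j + dep \<Sigma> f)) (bound_op A f j)"
      using A f n by (simp add: nominal_algebra_def)
    moreover have "abs_class ?P a vs \<in> carrier (abs_nom ?P)"
      using P by (auto simp: abs_class_def abs_nom_def prod_nom_def names_def intro!: quotientI)
    ultimately show ?thesis
      using BoundName act_abs_class_power_nom[OF L P, of \<pi> a]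
      unfolding equivariant_def by (metis act_prefix.simps(3) interp.simps(3))
  qed
  then show "interp \<Sigma> A \<eta> f j vs \<in> carrier (lev A (j + dep \<Sigma> f))"
    and "interp \<Sigma> A (act_prefix \<pi> \<eta>) f j (map (act (lev A j) \<pi>) vs) =
      act (lev A (j + dep \<Sigma> f)) \<pi> (interp \<Sigma> A \<eta> f j vs)" by auto
qed

lemma equivariant_eval:
  fixes A :: "('n::infinite, 'f, 'c) algebra"
  assumes A: "nominal_algebra \<Sigma> n A" and \<iota>: "equivariant X (lev A k) \<iota>"
    and n: "enat (k + m) \<le> n"
  shows "equivariant (Term \<Sigma> m X) (lev A (k + m)) (eval \<Sigma> A k \<iota> m)"
proof -
  have "eval \<Sigma> A k \<iota> m t \<in> carrier (lev A (k + m)) \<and>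
      eval \<Sigma> A k \<iota> m (act_trm X \<pi> t) = act (lev A (k + m)) \<pi> (eval \<Sigma> A k \<iota> m t)"
    if "has_depth \<Sigma> (carrier X) m t" for \<pi> t
    using that n
  proof induction
    case (1 x)
    then show ?case using \<iota> by (simp add: equivariant_def)
  next
    case (2 \<eta> f ts m)
    have n: "enat ((k + m) + dep \<Sigma> f) \<le> n" using 2 by (simp add: add.assoc)
    have IH: "eval \<Sigma> A k \<iota> m t \<in> carrier (lev A (k + m))"
      "eval \<Sigma> A k \<iota> m (act_trm X \<pi> t) = act (lev A (k + m)) \<pi> (eval \<Sigma> A k \<iota> m t)"
      if "t \<in> set ts" for t
      using 2 that enat_add_leD[OF n] by auto
    let ?vs = "map (eval \<Sigma> A k \<iota> m) ts"
    have vs: "length ?vs = ar \<Sigma> f" "set ?vs \<subseteq> carrier (lev A (k + m))"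
      using 2 IH by auto
    have "map (eval \<Sigma> A k \<iota> m) (map (act_trm X \<pi>) ts) = map (act (lev A (k + m)) \<pi>) ?vs"
      using IH by simp
    then show ?case
      using interp_equivariant[OF A 2(1) n vs]
      \<comment> \<open>Rewriting with \<open>eval_Op\<close> keeps the truncated subtraction of
        \<open>eval\<close> out of the goal.\<close>
      by (simp only: act_trm.simps eval_Op) (simp add: add.assoc)
  qed
  then show ?thesis by (auto simp: equivariant_def Term_def)
qed

text \<open>Variables sit at depth 0, so each \<open>\<sigma> y\<close> is evaluated at depth
  \<open>l\<close> from level \<open>k\<close>, and the rest of the term continues from level
  \<open>k + l\<close>. No capture condition is needed: substitution keeps bound names, and
  evaluation abstracts them only from the values of the arguments.\<close>

lemma eval_subst:
  assumes "has_depth \<Sigma> V m t"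
  shows "eval \<Sigma> A k \<iota> (m + l) (subst \<sigma> t) = eval \<Sigma> A (k + l) (\<lambda>y. eval \<Sigma> A k \<iota> l (\<sigma> y)) m t"
  using assms
proof induction
  case (1 x)
  then show ?case by simp
next
  case (2 \<eta> f ts m)
  have "m + dep \<Sigma> f + l = (m + l) + dep \<Sigma> f" "k + (m + l) = k + l + m" by simp_all
  moreover have "map (eval \<Sigma> A k \<iota> (m + l)) (map (subst \<sigma>) ts) =
      map (eval \<Sigma> A (k + l) (\<lambda>y. eval \<Sigma> A k \<iota> l (\<sigma> y)) m) ts"
    using 2 by simp
  ultimately show ?case by (simp only: subst.simps eval_Op)
qed

section \<open>Soundness\<close>

text \<open>An arbitrary \<open>k\<close> and \<open>\<iota>\<close> can stay fixed in the
  induction; only the bound on \<open>k + m\<close> varies with the depth. The axiom rule does move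
  to level \<open>k + l\<close>, but there it appeals to the model and not to the induction
  hypothesis.\<close>

lemma derivable_eval_eq:
  fixes T :: "('n::infinite, 'f, 'y) theory_pres" and A :: "('n, 'f, 'c) algebra"
  assumes T: "graded_theory T" and X: "nominal_set X" and M: "model T n A"
    and d: "derivable T X m t u"
    and k: "enat (k + m) \<le> n" and \<iota>: "equivariant X (lev A k) \<iota>"
  shows "eval (sig T) A k \<iota> m t = eval (sig T) A k \<iota> m u"
proof -
  let ?\<Sigma> = "sig T"
  have A: "nominal_algebra ?\<Sigma> n A" using M by (simp add: model_def)
  show ?thesis
    using d k
  proof induction
    case (deriv_cong \<eta> f ts us m)
    then have "enat (k + m) \<le> n" by (metis add.assoc enat_add_leD)
    then have "map (eval ?\<Sigma> A k \<iota> m) ts = map (eval ?\<Sigma> A k \<iota> m) us"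
      using deriv_cong by (intro nth_equalityI) auto
    then show ?case by (simp only: eval_Op)
  next
    case (deriv_ax e \<sigma> l \<tau>)
    let ?Y = "ctxt e" and ?d = "eq_depth e"
    define \<kappa> where "\<kappa> y = eval ?\<Sigma> A k \<iota> l (\<sigma> y)" for y
    have e: "is_equation ?\<Sigma> e" and s: "satisfies ?\<Sigma> n A ?Y ?d (lhs e) (rhs e)"
      using T M deriv_ax(1) by (auto simp: graded_theory_def model_def)
    then have Y: "nominal_set ?Y" by (simp add: is_equation_def)
    have n: "enat ((k + l) + ?d) \<le> n" using deriv_ax.prems by (simp add: ac_simps)
    then have kl: "enat (k + l) \<le> n" by (rule enat_add_leD)
    have "equivariant (Term ?\<Sigma> l X) (lev A (k + l)) (eval ?\<Sigma> A k \<iota> l)"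
      by (rule equivariant_eval[OF A \<iota> kl])
    then have \<kappa>: "equivariant ?Y (lev A (k + l)) \<kappa>"
      using deriv_ax(2,3) kl unfolding equivariant_def \<kappa>_def by metis
    have eq: "eval ?\<Sigma> A (k + l) \<kappa> ?d (lhs e) = eval ?\<Sigma> A (k + l) \<kappa> ?d (rhs e)"
      using s \<kappa> n by (simp add: satisfies_def)
    \<comment> \<open>Since evaluation under \<open>\<kappa>\<close> is equivariant, the renaming
      \<open>\<tau>\<close> of the axiom comes out as an action on the value, the same for both
      sides.\<close>
    have "eval ?\<Sigma> A k \<iota> (?d + l) (subst \<sigma> (act (Term ?\<Sigma> ?d ?Y) \<tau> r)) =
        act (lev A (k + l + ?d)) \<tau> (eval ?\<Sigma> A (k + l) \<kappa> ?d r)"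
      if r: "r \<in> carrier (Term ?\<Sigma> ?d ?Y)" for r
    proof -
      have "has_depth ?\<Sigma> (carrier ?Y) ?d (act (Term ?\<Sigma> ?d ?Y) \<tau> r)"
        using nominal_setD(1)[OF nominal_set_Term[OF Y] r] by (simp add: Term_def)
      from eval_subst[OF this, of A k \<iota> l \<sigma>] show ?thesis
        using equivariant_eval[OF A \<kappa> n] r by (simp add: equivariant_def flip: \<kappa>_def)
    qed
    then show ?case using e eq by (simp add: is_equation_def)
  next
    case (deriv_perm h a b ts us m)
    let ?L = "lev A (k + m)" and ?E = "eval ?\<Sigma> A k \<iota> m"
    let ?P = "power_nom (ar ?\<Sigma> h) ?L"
    have km: "enat (k + m) \<le> n" using deriv_perm.prems by (metis add.assoc enat_add_leD)
    then have L: "nominal_set ?L" using A by (simp add: nominal_algebra_def)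
    have E: "equivariant (Term ?\<Sigma> m X) ?L ?E" by (rule equivariant_eval[OF A \<iota> km])
    have us: "u \<in> carrier (Term ?\<Sigma> m X)" "fresh (Term ?\<Sigma> m X) a u" if "u \<in> set us" for u
      using deriv_perm that by (metis in_set_conv_nth)+
    have c: "map ?E us \<in> carrier ?P"
      using E us deriv_perm by (auto simp: equivariant_def power_nom_def)
    have "fresh ?P a (map ?E us)"
      using fresh_equivariant[OF nominal_set_Term[OF X] L E] us
      by (intro fresh_power_nom L c) auto
    then have "abs_class ?P a (act ?P \<langle>a \<leftrightarrow> b\<rangle> (map ?E us)) = abs_class ?P b (map ?E us)"
      by (rule abs_class_swap[OF nominal_set_power_nom[OF L] c deriv_perm(2)])
    \<comment> \<open>The induction hypothesis equates the value of each \<open>ts ! i\<close> with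
      that of the swapped \<open>us ! i\<close>; equivariance of evaluation moves the swap onto the
      value.\<close>
    moreover have "act ?P \<langle>a \<leftrightarrow> b\<rangle> (map ?E us) = map ?E ts"
      using deriv_perm km E by (intro nth_equalityI) (auto simp: power_nom_def equivariant_def)
    ultimately show ?case by (simp only: eval_Op interp.simps)
  qed simp_all
qed

theorem theorem1:
  fixes T :: "('n::{countable,infinite}, 'f, 'y) theory_pres"
    and X :: "('n, 'x) nomset"
    and m :: nat
    and t u :: "('n, 'f, 'x) trm"
  assumes "graded_theory T"
    and "nominal_set X"
    and "t \<in> carrier (Term (sig T) m X)"
    and "u \<in> carrier (Term (sig T) m X)"
    and "derivable T X m t u"
  shows "\<forall>(n::enat) (A :: ('n, 'f, 'c) algebra). model T n A \<longrightarrow> satisfies (sig T) n A X m t u"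
  unfolding satisfies_def
  by (intro allI impI; elim conjE) (rule derivable_eval_eq[OF assms(1,2) _ assms(5)])

end
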